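(* As formal power series in independent variables $q,a,b,t$, \[ \sum_{\substack{(\pi_1,\pi_2)\in \mathcal{D}\times\mathcal{P}\\ l(\pi_2)\leq \nu(\pi_1)}} t^{\nu(\pi_1)+\nu(\pi_2)}a^{\nu(\pi_2)}b^{\nu(\pi_1)}q^{|\pi_1|+|\pi_2|} \;=\; \sum_{\substack{(\pi^*_1,\pi^*_2)\in\mathcal{D}\times\mathcal{P}\\ d(\pi^*_2)\leq r(\pi^*_1)}} t^{\nu(\pi^*_1)+\nu(\pi^*_2)}a^{\nu(\pi^*_2)}b^{\nu(\pi^*_1)}q^{|\pi^*_1|+|\pi^*_2|}. \]
   Context: A partition is a finite non-increasing sequence of positive integers (the empty partition allowed). $\mathcal{P}$ is the set of all partitions and $\mathcal{D}$ the set of partitions into distinct parts. For a partition $\pi$: $|\pi|$ is the sum of parts, $\nu(\pi)$ the number of parts, $l(\pi)$ the largest part ($0$ for the empty partition), $d(\pi)$ the side length of the Durfee square (the largest $d$ such that $\pi$ has at least $d$ parts each $\ge d$), and $r(\pi)$ the largest $r\ge0$ such that each of $1,2,\dots,r$ is a part of $\pi$. *)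

theory Defs
  imports
    "HOL-Analysis.Infinite_Sum"
    "HOL-Computational_Algebra.Formal_Power_Series"
begin

definition partitions :: "nat list set" where
  "partitions = {p. sorted_wrt (\<ge>) p \<and> (\<forall>x\<in>set p. 0 < x)}"

definition distinct_partitions :: "nat list set" where
  "distinct_partitions = {p \<in> partitions. distinct p}"

definition largest_part :: "nat list \<Rightarrow> nat" where
  "largest_part p = (if p = [] then 0 else Max (set p))"

text \<open>Both \<open>GREATEST\<close>s below are attained: the predicate holds at 0 and fails
  above \<open>length p\<close>. In the first one parts are counted with multiplicity.\<close>

definition durfee :: "nat list \<Rightarrow> nat" where
  "durfee p = (GREATEST d. d \<le> length (filter (\<lambda>x. d \<le> x) p))"

definition initial_run :: "nat list \<Rightarrow> nat" where
  "initial_run p = (GREATEST r. {1..r} \<subseteq> set p)"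

text \<open>Formal power series over the integers in the independent variables \<open>q\<close>, \<open>a\<close>,
  \<open>b\<close>, \<open>t\<close> form the ring \<open>\<int>[[t]][[b]][[a]][[q]]\<close>, with \<open>q\<close> outermost. Infinite sums
  in it are unordered sums for the library's metric on \<^typ>\<open>'a fps\<close>, i.e. for
  the \<open>q\<close>-adic topology: the coefficient of every power of \<open>q\<close> (a series in \<open>a\<close>,
  \<open>b\<close>, \<open>t\<close>) has to stabilise. This implies stabilisation of the coefficient of each
  single monomial, so the sums are also the coefficientwise ones.\<close>

type_synonym series = "int fps fps fps fps"

definition var_q :: series where
  "var_q = fps_X"

definition var_a :: series where
  "var_a = fps_const fps_X"

definition var_b :: series where
  "var_b = fps_const (fps_const fps_X)"

definition var_t :: series where
  "var_t = fps_const (fps_const (fps_const fps_X))"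

definition weight :: "nat list \<times> nat list \<Rightarrow> series" where
  "weight = (\<lambda>(p1, p2). var_t ^ (length p1 + length p2) * var_a ^ length p2 *
     var_b ^ length p1 * var_q ^ (sum_list p1 + sum_list p2))"

end

theory Submission
  imports Defs
begin

text \<open>
  Fix the numbers of parts \<open>n\<close> of the first and \<open>m\<close> of the second partition, and let \<open>G n\<close> and
  \<open>B d e\<close> be the generating functions (in the size) of the partitions with at most \<open>n\<close> parts, and
  with at most \<open>d\<close> parts, each at most \<open>e\<close>. On the left, cutting the second partition, whose
  parts are at most \<open>n\<close>, along its Durfee square of side \<open>d\<close> leaves a partition in a
  \<open>d \<times> (n - d)\<close> box and one with \<open>m - d\<close> parts, each at most \<open>d\<close>. On the right the box is
  replaced by an arbitrary partition with at most \<open>d\<close> parts, while the first partition is required to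
  contain \<open>1, \<dots>, d\<close>. Removing a staircase shows that partitions into \<open>n\<close> distinct
  parts containing \<open>1, \<dots>, d\<close> contribute \<open>q\<close> to the power \<open>n (n + 1) / 2\<close> times
  \<open>G (n - d)\<close>. The two sides therefore agree term by term in \<open>d\<close>, by
  \<open>G n * B d (n - d) = G d * G (n - d)\<close>.
\<close>

unbundle fps_syntax

section \<open>Generating functions by size\<close>

definition gf :: "('a \<Rightarrow> nat) \<Rightarrow> 'a set \<Rightarrow> int fps" where
  "gf w S = Abs_fps (\<lambda>N. int (card {x\<in>S. w x = N}))"

text \<open>\<open>card\<close> is 0 on infinite sets, so \<open>gf\<close> is an honest count only
  when every fibre of the weight is finite.\<close>

definition finite_fibres :: "('a \<Rightarrow> nat) \<Rightarrow> 'a set \<Rightarrow> bool" where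
  "finite_fibres w S \<longleftrightarrow> (\<forall>N. finite {x\<in>S. w x = N})"

lemma gf_nth [simp]: "gf w S $ N = int (card {x\<in>S. w x = N})"
  by (simp add: gf_def)

lemma finite_fibres_subset: "finite_fibres w T \<Longrightarrow> S \<subseteq> T \<Longrightarrow> finite_fibres w S"
  unfolding finite_fibres_def by (auto intro: finite_subset[rotated])

lemma gf_Un:
  assumes "finite_fibres w S" "finite_fibres w T" "S \<inter> T = {}"
  shows "gf w (S \<union> T) = gf w S + gf w T"
proof (rule fps_ext)
  fix N
  have "{x\<in>S \<union> T. w x = N} = {x\<in>S. w x = N} \<union> {x\<in>T. w x = N}"
    by auto
  moreover have "card \<dots> = card {x\<in>S. w x = N} + card {x\<in>T. w x = N}"
    using assms by (intro card_Un_disjoint) (auto simp: finite_fibres_def)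
  ultimately show "gf w (S \<union> T) $ N = (gf w S + gf w T) $ N"
    by simp
qed

lemma gf_UN:
  assumes "finite I" "\<And>i. i \<in> I \<Longrightarrow> finite_fibres w (S i)"
    and "\<And>i j. i \<in> I \<Longrightarrow> j \<in> I \<Longrightarrow> i \<noteq> j \<Longrightarrow> S i \<inter> S j = {}"
  shows "gf w (\<Union>i\<in>I. S i) = (\<Sum>i\<in>I. gf w (S i))"
proof (rule fps_ext)
  fix N
  have "{x\<in>\<Union>i\<in>I. S i. w x = N} = (\<Union>i\<in>I. {x\<in>S i. w x = N})"
    by auto
  also have "card \<dots> = (\<Sum>i\<in>I. card {x\<in>S i. w x = N})"
    using assms unfolding finite_fibres_def by (intro card_UN_disjoint) blast+
  finally show "gf w (\<Union>i\<in>I. S i) $ N = (\<Sum>i\<in>I. gf w (S i)) $ N"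
    by (simp add: fps_sum_nth)
qed

lemma gf_bij_betw:
  assumes "bij_betw h S T" "\<And>x. x \<in> S \<Longrightarrow> w (h x) = w' x + k"
  shows "gf w T = fps_X ^ k * gf w' S"
proof (rule fps_ext)
  fix N
  have "card {y\<in>T. w y = N} = card (h ` {x\<in>S. w' x + k = N})"
    using assms by (intro arg_cong[where f = card]) (auto simp: bij_betw_def image_iff)
  also have "\<dots> = card {x\<in>S. w' x + k = N}"
    using assms(1) by (intro card_image) (auto simp: bij_betw_def inj_on_def)
  also have "{x\<in>S. w' x + k = N} = (if N < k then {} else {x\<in>S. w' x = N - k})"
    by auto
  finally show "gf w T $ N = (fps_X ^ k * gf w' S) $ N"
    by (simp add: fps_X_power_mult_nth)
qed

text \<open>The fibre over \<open>N\<close> is the disjoint union over \<open>i\<close> of the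
  products of the fibres over \<open>i\<close> and \<open>N - i\<close>, and counting it gives the
  Cauchy product.\<close>

lemma gf_Times:
  assumes "finite_fibres v S" "finite_fibres w T"
  shows "gf (\<lambda>(x, y). v x + w y) (S \<times> T) = gf v S * gf w T"
    and "finite_fibres (\<lambda>(x, y). v x + w y) (S \<times> T)"
proof -
  let ?F = "\<lambda>N i. {x\<in>S. v x = i} \<times> {y\<in>T. w y = N - i}"
  have eq: "{z\<in>S \<times> T. (case z of (x, y) \<Rightarrow> v x + w y) = N} = (\<Union>i\<in>{0..N}. ?F N i)" for N
    by auto
  have fin: "finite (?F N i)" for N i
    using assms by (simp add: finite_fibres_def)
  show "finite_fibres (\<lambda>(x, y). v x + w y) (S \<times> T)"
    unfolding finite_fibres_def eq using fin by blast
  show "gf (\<lambda>(x, y). v x + w y) (S \<times> T) = gf v S * gf w T"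
  proof (rule fps_ext)
    fix N
    have "card (\<Union>i\<in>{0..N}. ?F N i) = (\<Sum>i=0..N. card (?F N i))"
      using fin by (intro card_UN_disjoint) auto
    then show "gf (\<lambda>(x, y). v x + w y) (S \<times> T) $ N = (gf v S * gf w T) $ N"
      unfolding gf_nth eq fps_mult_nth by (simp add: card_cartesian_product)
  qed
qed

section \<open>Partitions with at most d parts, and partitions in a box\<close>

text \<open>A partition with at most \<open>d\<close> parts is encoded by padding it with zeros to length \<open>d\<close>.\<close>

definition weak_parts :: "nat \<Rightarrow> nat list set" where
  "weak_parts d = {p. sorted_wrt (\<ge>) p \<and> length p = d}"

definition box :: "nat \<Rightarrow> nat \<Rightarrow> nat list set" where
  "box d e = {p \<in> weak_parts d. \<forall>x\<in>set p. x \<le> e}"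

lemma finite_fibres_length: "finite_fibres sum_list {p :: nat list. length p = n}"
proof (unfold finite_fibres_def, rule allI)
  fix N
  have "{p\<in>{p :: nat list. length p = n}. sum_list p = N} \<subseteq> {p. set p \<subseteq> {..N} \<and> length p = n}"
    using member_le_sum_list by auto
  then show "finite {p\<in>{p :: nat list. length p = n}. sum_list p = N}"
    by (rule finite_subset) (simp add: finite_lists_length_eq)
qed

lemma finite_fibres_weak_parts: "finite_fibres sum_list (weak_parts d)"
  by (rule finite_fibres_subset[OF finite_fibres_length[of d]]) (auto simp: weak_parts_def)

lemma map_Suc_pred: "\<forall>x\<in>set p. 0 < x \<Longrightarrow> map Suc (map (\<lambda>x. x - 1) p) = p"
  by (induction p) auto

text \<open>The last entry is the smallest. If it is zero, it can be deleted; otherwise every entry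
  is positive and one can be subtracted from each, which costs q to the power \<open>Suc d\<close>.
  \<open>S\<close>, \<open>T\<close> and \<open>U\<close> are kept general so that weakly decreasing
  lists, boxes and strictly decreasing lists are all covered.\<close>

lemma gf_last_split:
  assumes "\<And>p. p \<in> S \<Longrightarrow> length p = Suc d \<and> sorted_wrt (\<ge>) p"
    and "\<And>p. p \<in> T \<Longrightarrow> length p = d"
    and "\<And>p. p @ [0] \<in> S \<longleftrightarrow> p \<in> T"
    and "\<And>p. map Suc p \<in> S \<longleftrightarrow> p \<in> U"
  shows "gf sum_list S = gf sum_list T + fps_X ^ Suc d * gf sum_list U"
proof -
  let ?S0 = "{p\<in>S. 0 \<in> set p}" and ?S1 = "{p\<in>S. 0 \<notin> set p}"
  have fin: "finite_fibres sum_list S"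
    using assms(1) by (intro finite_fibres_subset[OF finite_fibres_length[of "Suc d"]]) auto
  have "gf sum_list S = gf sum_list (?S0 \<union> ?S1)"
    by (rule arg_cong[where f = "gf sum_list"]) auto
  also have "\<dots> = gf sum_list ?S0 + gf sum_list ?S1"
    by (intro gf_Un finite_fibres_subset[OF fin]) auto
  also have "gf sum_list ?S0 = fps_X ^ 0 * gf sum_list T"
  proof (rule gf_bij_betw)
    have "\<exists>p'. p = p' @ [0]" if "p \<in> S" "0 \<in> set p" for p
    proof -
      from assms(1)[OF that(1)] obtain p' x where p: "p = p' @ [x]" "sorted_wrt (\<ge>) p"
        by (metis append_butlast_last_id length_0_conv nat.distinct(1))
      with that(2) have "x = 0"
        by (auto simp: sorted_wrt_append)
      with p show ?thesis by blast
    qed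
    then show "bij_betw (\<lambda>p. p @ [0]) T ?S0"
      using assms(3) by (fastforce simp: bij_betw_def inj_on_def)
  qed simp
  also have "gf sum_list ?S1 = fps_X ^ Suc d * gf sum_list U"
  proof (rule gf_bij_betw)
    have "\<exists>p'. p = map Suc p'" if "0 \<notin> set p" for p
      using map_Suc_pred[of p] that by (metis bot_nat_0.not_eq_extremum)
    then show "bij_betw (map Suc) U ?S1"
      using assms(4) by (fastforce simp: bij_betw_def inj_on_def)
    show "sum_list (map Suc p) = sum_list p + Suc d" if "p \<in> U" for p
      using assms(1)[of "map Suc p"] assms(4)[of p] that by (simp add: sum_list_Suc)
  qed
  finally show ?thesis by simp
qed

text \<open>An implicit recurrence: with G n for the series of \<open>weak_parts n\<close>, it says
  (1 - q^(d+1)) G (d+1) = G d, so that G n is the inverse of (1 - q) ... (1 - q^n).\<close>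

lemma gf_weak_parts_Suc:
  "gf sum_list (weak_parts (Suc d)) =
     gf sum_list (weak_parts d) + fps_X ^ Suc d * gf sum_list (weak_parts (Suc d))"
  by (rule gf_last_split) (auto simp: weak_parts_def sorted_wrt_append sorted_wrt_map)

text \<open>The q-Pascal rule: the series of \<open>box d e\<close> is the Gaussian binomial
  coefficient of d + e over d.\<close>

lemma gf_box_Suc_Suc:
  "gf sum_list (box (Suc d) (Suc e)) =
     gf sum_list (box d (Suc e)) + fps_X ^ Suc d * gf sum_list (box (Suc d) e)"
  by (rule gf_last_split) (auto simp: box_def weak_parts_def sorted_wrt_append sorted_wrt_map)

lemma gf_singleton: "gf w {x} = fps_X ^ w x"
proof (rule fps_ext)
  fix N
  have "{y\<in>{x}. w y = N} = (if N = w x then {x} else {})"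
    by auto
  then show "gf w {x} $ N = fps_X ^ w x $ N"
    by (simp add: fps_X_power_nth)
qed

lemma gf_weak_parts_0: "gf sum_list (weak_parts 0) = 1"
proof -
  have "weak_parts 0 = {[]}"
    by (auto simp: weak_parts_def)
  then show ?thesis
    by (simp add: gf_singleton)
qed

lemma gf_box_0:
  "gf sum_list (box 0 e) = 1" "gf sum_list (box d 0) = 1"
proof -
  have *: "box 0 e = {[]}"
    by (auto simp: box_def weak_parts_def)
  have "p = replicate d 0" if "p \<in> box d 0" for p
    using that replicate_eqI[of p d 0] by (auto simp: box_def weak_parts_def)
  moreover have "replicate d 0 \<in> box d 0"
    by (auto simp: box_def weak_parts_def sorted_wrt_iff_nth_less)
  ultimately have "box d 0 = {replicate d 0}"
    by blast
  with * show "gf sum_list (box 0 e) = 1" "gf sum_list (box d 0) = 1"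
    by (simp_all add: gf_singleton sum_list_replicate)
qed

lemma one_minus_fps_X_power_neq_0: "(1 :: int fps) - fps_X ^ Suc d \<noteq> 0"
proof
  assume "(1 :: int fps) - fps_X ^ Suc d = 0"
  then have "((1 :: int fps) - fps_X ^ Suc d) $ 0 = 0 $ 0"
    by simp
  then show False by simp
qed

text \<open>The product formula for Gaussian binomials with denominators cleared. In the induction
  both sides are multiplied by 1 - q^(d+e), which lowers \<open>weak_parts (d + e)\<close> by one,
  and the q-Pascal rule splits the box.\<close>

lemma gf_weak_parts_times_box:
  "gf sum_list (weak_parts (d + e)) * gf sum_list (box d e) =
     gf sum_list (weak_parts d) * gf sum_list (weak_parts e)"
proof (induction "d + e" arbitrary: d e)
  case 0
  then show ?case by (simp add: gf_weak_parts_0 gf_box_0)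
next
  case (Suc k)
  show ?case
  proof (cases "d = 0 \<or> e = 0")
    case True
    then show ?thesis by (auto simp: gf_weak_parts_0 gf_box_0)
  next
    case False
    then obtain d' e' where de: "d = Suc d'" "e = Suc e'"
      by (metis not0_implies_Suc)
    define x :: "int fps" where "x = fps_X ^ d"
    define y :: "int fps" where "y = fps_X ^ e"
    let ?G = "\<lambda>n. gf sum_list (weak_parts n)" and ?B = "\<lambda>d e. gf sum_list (box d e)"
    have k: "k = d' + e" "k = d + e'" "d + e = Suc k"
      using Suc.hyps(2) de by auto
    have Gd: "(1 - x) * ?G d = ?G d'" and Ge: "(1 - y) * ?G e = ?G e'"
      using gf_weak_parts_Suc[of d'] gf_weak_parts_Suc[of e'] de
      by (simp_all add: x_def y_def algebra_simps)
    have xy: "fps_X ^ Suc k = x * y"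
      by (simp add: x_def y_def k(3)[symmetric] power_add)
    have Gk: "(1 - x * y) * ?G (d + e) = ?G k"
      using gf_weak_parts_Suc[of k] unfolding k(3) xy by (simp add: algebra_simps)
    have B: "?B d e = ?B d' e + x * ?B d e'"
      using gf_box_Suc_Suc[of d' e'] by (simp add: de x_def)
    have "(1 - x * y) * (?G (d + e) * ?B d e) = ?G k * ?B d e"
      using Gk by (simp add: mult.assoc[symmetric])
    also have "\<dots> = ?G (d' + e) * ?B d' e + x * (?G (d + e') * ?B d e')"
      using k(1,2) by (simp add: B distrib_left mult_ac)
    also have "\<dots> = ?G d' * ?G e + x * (?G d * ?G e')"
      using Suc.hyps(1)[OF k(1)] Suc.hyps(1)[OF k(2)] by simp
    \<comment> \<open>After factoring out G d and G e this is (1 - x) + x (1 - y) = 1 - x y.\<close>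
    also have "\<dots> = (1 - x * y) * (?G d * ?G e)"
      by (simp add: Gd[symmetric] Ge[symmetric] algebra_simps)
    finally show ?thesis
      using one_minus_fps_X_power_neq_0[of k] unfolding xy by (metis mult_left_cancel)
  qed
qed

section \<open>Distinct partitions containing an initial run\<close>

definition distinct_run :: "nat \<Rightarrow> nat \<Rightarrow> nat list set" where
  "distinct_run n d = {p \<in> distinct_partitions. length p = n \<and> {1..d} \<subseteq> set p}"

lemma distinct_partitions_iff:
  "p \<in> distinct_partitions \<longleftrightarrow> sorted_wrt (>) p \<and> 0 \<notin> set p"
proof -
  have "sorted_wrt (\<ge>) p \<and> distinct p \<longleftrightarrow> sorted_wrt (>) p"
    by (induction p) (auto simp: order.order_iff_strict)
  then show ?thesis
    by (auto simp: distinct_partitions_def partitions_def intro: Nat.gr0I)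
qed

text \<open>Unlike \<open>distinct_partitions\<close>, these lists may end in 0, so that
  \<open>gf_last_split\<close> yields a recurrence for them.\<close>

definition strict_lists :: "nat \<Rightarrow> nat list set" where
  "strict_lists n = {p. sorted_wrt (>) p \<and> length p = n}"

text \<open>As \<open>{1..0}\<close> is empty, \<open>distinct_run n 0\<close> consists of all
  partitions into \<open>n\<close> distinct parts.\<close>

lemma bij_betw_map_Suc_strict: "bij_betw (map Suc) (strict_lists n) (distinct_run n 0)"
proof -
  have "\<exists>p'. p = map Suc p'" if "0 \<notin> set p" for p
    using map_Suc_pred[of p] that by (metis bot_nat_0.not_eq_extremum)
  then have "distinct_run n 0 \<subseteq> map Suc ` strict_lists n"
    by (fastforce simp: strict_lists_def distinct_run_def distinct_partitions_iff sorted_wrt_map)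
  then show ?thesis
    by (auto simp: bij_betw_def inj_on_def strict_lists_def distinct_run_def
        distinct_partitions_iff sorted_wrt_map)
qed

lemma gf_distinct_run_0: "gf sum_list (distinct_run n 0) = fps_X ^ n * gf sum_list (strict_lists n)"
  by (rule gf_bij_betw[OF bij_betw_map_Suc_strict]) (auto simp: strict_lists_def sum_list_Suc)

lemma gf_strict_lists_Suc:
  "gf sum_list (strict_lists (Suc n)) =
     gf sum_list (distinct_run n 0) + fps_X ^ Suc n * gf sum_list (strict_lists (Suc n))"
proof (rule gf_last_split)
  show "length p = Suc n \<and> sorted_wrt (\<ge>) p" if "p \<in> strict_lists (Suc n)" for p
    using that sorted_wrt_mono_rel[of p "(>)" "(\<ge>)"] by (auto simp: strict_lists_def)
  show "p @ [0] \<in> strict_lists (Suc n) \<longleftrightarrow> p \<in> distinct_run n 0" for p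
    by (auto simp: strict_lists_def distinct_run_def distinct_partitions_iff sorted_wrt_append
        intro: Nat.gr0I)
qed (auto simp: strict_lists_def distinct_run_def sorted_wrt_map)

text \<open>The staircase is removed through recurrences instead of an explicit bijection: passing
  from n to n + 1 divides both the strict and the weak series by the same factor 1 - q^(n+1), which
  is then cancelled.\<close>

lemma gf_distinct_run_0_eq:
  "gf sum_list (distinct_run n 0) = fps_X ^ (\<Sum>{1..n}) * gf sum_list (weak_parts n)"
proof (induction n)
  case 0
  have "distinct_run 0 0 = {[]}"
    by (auto simp: distinct_run_def distinct_partitions_iff)
  then show ?case
    by (simp add: gf_singleton gf_weak_parts_0)
next
  case (Suc n)
  let ?S = "gf sum_list (strict_lists (Suc n))" and ?G = "\<lambda>n. gf sum_list (weak_parts n)"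
  have "(1 - fps_X ^ Suc n) * ?S = gf sum_list (distinct_run n 0)"
    using gf_strict_lists_Suc[of n] by (simp add: algebra_simps)
  also have "\<dots> = fps_X ^ (\<Sum>{1..n}) * ((1 - fps_X ^ Suc n) * ?G (Suc n))"
  proof -
    have "(1 - fps_X ^ Suc n) * ?G (Suc n) = ?G n"
      using gf_weak_parts_Suc[of n] by (simp add: algebra_simps)
    then show ?thesis
      using Suc by simp
  qed
  finally have "(1 - fps_X ^ Suc n) * ?S = (1 - fps_X ^ Suc n) * (fps_X ^ (\<Sum>{1..n}) * ?G (Suc n))"
    by (simp only: mult_ac)
  then have "?S = fps_X ^ (\<Sum>{1..n}) * ?G (Suc n)"
    using one_minus_fps_X_power_neq_0 mult_left_cancel by blast
  then show ?case
    by (simp add: gf_distinct_run_0 power_add mult_ac)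
qed

text \<open>Inverse direction: the part 1 comes last; deleting it and lowering the other parts by
  one shortens the required run by one.\<close>

lemma bij_betw_distinct_run_Suc:
  "bij_betw (\<lambda>p. map Suc p @ [1]) (distinct_run n d) (distinct_run (Suc n) (Suc d))"
proof -
  have *: "{1..Suc d} \<subseteq> insert 1 (Suc ` A) \<longleftrightarrow> {1..d} \<subseteq> A" if "0 \<notin> A" for A
  proof -
    have "{1..Suc d} = insert 1 (Suc ` {1..d})"
      unfolding image_Suc_atLeastAtMost by auto
    then have "{1..Suc d} \<subseteq> insert 1 (Suc ` A) \<longleftrightarrow> Suc ` {1..d} \<subseteq> Suc ` A"
      by (auto simp: subset_insert simp del: image_Suc_atLeastAtMost)
    then show ?thesis
      by (simp only: inj_image_subset_iff inj_Suc)
  qed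
  have "\<exists>p'. p = map Suc p' @ [1] \<and> p' \<in> distinct_run n d" if p: "p \<in> distinct_run (Suc n) (Suc d)" for p
  proof -
    from p obtain r x where r: "p = r @ [x]"
      by (metis (mono_tags, lifting) append_butlast_last_id distinct_run_def length_0_conv mem_Collect_eq nat.distinct(1))
    have "1 \<in> set p" "0 \<notin> set p" "sorted_wrt (>) p"
      using p by (auto simp: distinct_run_def distinct_partitions_iff)
    \<comment> \<open>A strictly decreasing list ends in its minimum, which is 1 because 1 occurs
      and 0 does not.\<close>
    then have x: "x = 1" and r1: "\<forall>y\<in>set r. 1 < y"
      using r by (fastforce simp: sorted_wrt_append)+
    define p' where "p' = map (\<lambda>x. x - 1) r"
    have r': "r = map Suc p'"
      unfolding p'_def by (rule map_Suc_pred[symmetric]) (use r1 in auto)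
    have "0 \<notin> set p'"
      using r1 unfolding r' by auto
    with p have "p' \<in> distinct_run n d"
      unfolding r x r' using *[of "set p'"]
      by (auto simp: distinct_run_def distinct_partitions_iff sorted_wrt_append sorted_wrt_map)
    with r x r' show ?thesis by blast
  qed
  moreover have "map Suc p @ [1] \<in> distinct_run (Suc n) (Suc d)" if "p \<in> distinct_run n d" for p
  proof -
    have "0 \<notin> set p" using that by (auto simp: distinct_run_def distinct_partitions_iff)
    with that *[of "set p"] show ?thesis
      by (auto simp: distinct_run_def distinct_partitions_iff sorted_wrt_append sorted_wrt_map
          intro: Nat.gr0I)
  qed
  ultimately show ?thesis
    by (fastforce simp: bij_betw_def inj_on_def)
qed

text \<open>Shortening the run \<open>d\<close> times costs n + (n - 1) + ... + (n - d + 1); the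
  staircase of the remaining \<open>n - d\<close> parts completes this to the full triangular
  number, whatever \<open>d\<close> is.\<close>

lemma gf_distinct_run:
  "d \<le> n \<Longrightarrow> gf sum_list (distinct_run n d) = fps_X ^ (\<Sum>{1..n}) * gf sum_list (weak_parts (n - d))"
proof (induction d arbitrary: n)
  case 0
  then show ?case by (simp add: gf_distinct_run_0_eq)
next
  case (Suc d)
  then obtain m where n: "n = Suc m" "d \<le> m"
    by (cases n) auto
  have "gf sum_list (distinct_run n (Suc d)) = fps_X ^ Suc m * gf sum_list (distinct_run m d)"
    unfolding n(1)
    by (rule gf_bij_betw[OF bij_betw_distinct_run_Suc]) (auto simp: distinct_run_def sum_list_Suc)
  then show ?case
    using Suc.IH[OF n(2)] by (simp add: n power_add mult_ac)
qed

section \<open>Decomposition along the Durfee square\<close>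

definition bounded_parts :: "nat \<Rightarrow> nat \<Rightarrow> nat list set" where
  "bounded_parts n m = {p \<in> partitions. length p = m \<and> (\<forall>x\<in>set p. x \<le> n)}"

definition durfee_parts :: "nat \<Rightarrow> nat \<Rightarrow> nat list set" where
  "durfee_parts d m = {p \<in> partitions. length p = m \<and> durfee p = d}"

text \<open>For \<open>e\<close> above \<open>length r\<close> no entry of \<open>s\<close> reaches
  \<open>e\<close>, and \<open>r\<close> alone has fewer than \<open>e\<close> entries.\<close>

lemma durfee_append:
  assumes "\<forall>x\<in>set r. length r \<le> x" "\<forall>x\<in>set s. x \<le> length r"
  shows "durfee (r @ s) = length r"
  unfolding durfee_def
proof (rule Greatest_equality)
  show "length r \<le> length (filter (\<lambda>x. length r \<le> x) (r @ s))"
    using assms(1) by simp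
  fix e assume e: "e \<le> length (filter (\<lambda>x. e \<le> x) (r @ s))"
  show "e \<le> length r"
  proof (rule ccontr)
    assume "\<not> e \<le> length r"
    then have "filter (\<lambda>x. e \<le> x) s = []"
      using assms(2) by (auto simp: filter_empty_conv)
    with e have "e \<le> length (filter (\<lambda>x. e \<le> x) r)"
      by simp
    also have "\<dots> \<le> length r"
      by (rule length_filter_le)
    finally show False
      using \<open>\<not> e \<le> length r\<close> by simp
  qed
qed

lemma durfee_split:
  assumes "sorted_wrt (\<ge>) p"
  shows "durfee p \<le> length p"
    and "\<forall>x\<in>set (take (durfee p) p). durfee p \<le> x"
    and "\<forall>x\<in>set (drop (durfee p) p). x \<le> durfee p"
proof -
  let ?d = "durfee p"
  let ?P = "\<lambda>d. d \<le> length (filter (\<lambda>x. d \<le> x) p)"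
  have bound: "d \<le> length p" if "?P d" for d
    using that length_filter_le le_trans by blast
  have d: "?P ?d"
    unfolding durfee_def by (rule GreatestI_nat[of ?P 0 "length p"]) (auto dest: bound)
  have max: "d \<le> ?d" if "?P d" for d
    unfolding durfee_def by (rule Greatest_le_nat[of ?P d "length p"]) (use that bound in auto)
  show "?d \<le> length p"
    using bound[OF d] .
  define r s where "r = take ?d p" and "s = drop ?d p"
  have p: "p = r @ s" and r: "length r = ?d"
    using bound[OF d] by (simp_all add: r_def s_def)
  have rs: "y \<le> x" if "x \<in> set r" "y \<in> set s" for x y
    using assms that unfolding p by (simp add: sorted_wrt_append)
  show "\<forall>x\<in>set (take ?d p). ?d \<le> x"
  proof (rule ccontr)
    assume "\<not> ?thesis"
    \<comment> \<open>A small entry in \<open>r\<close> bounds all of \<open>s\<close> from above,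
      leaving fewer than \<open>durfee p\<close> entries that count, although the maximum is
      attained.\<close>
    then obtain x where x: "x \<in> set r" "x < ?d"
      by (auto simp: r_def not_le)
    then have "filter (\<lambda>x. ?d \<le> x) s = []"
      using rs by (fastforce simp: filter_empty_conv)
    moreover have "length (filter (\<lambda>x. ?d \<le> x) r) < length r"
      using x by (intro length_filter_less) auto
    ultimately show False
      using d r arg_cong[OF p, of "\<lambda>p. length (filter (\<lambda>x. ?d \<le> x) p)"] by simp
  qed
  show "\<forall>x\<in>set (drop ?d p). x \<le> ?d"
  proof (rule ccontr)
    assume "\<not> ?thesis"
    \<comment> \<open>A large entry in \<open>s\<close> lifts all of \<open>r\<close>, so a square
      of side \<open>durfee p + 1\<close> would fit, against maximality.\<close>
    then obtain y where y: "y \<in> set s" "Suc ?d \<le> y"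
      by (auto simp: s_def not_le)
    then have "filter (\<lambda>x. Suc ?d \<le> x) r = r"
      using rs by (fastforce simp: filter_id_conv)
    moreover have "filter (\<lambda>x. Suc ?d \<le> x) s \<noteq> []"
      using y by (auto simp: filter_empty_conv)
    ultimately have "Suc ?d \<le> length (filter (\<lambda>x. Suc ?d \<le> x) p)"
      using r arg_cong[OF p, of "\<lambda>p. length (filter (\<lambda>x. Suc ?d \<le> x) p)"]
      by (cases "filter (\<lambda>x. Suc ?d \<le> x) s") auto
    from max[OF this] show False by simp
  qed
qed

text \<open>This turns the condition on the right-hand side into the containment used in
  \<open>distinct_run\<close>. The maximum exists because \<open>{1..r}\<close> inside
  \<open>set p\<close> forces \<open>r\<close> to be at most \<open>length p\<close>.\<close>

lemma le_initial_run_iff: "d \<le> initial_run p \<longleftrightarrow> {1..d} \<subseteq> set p"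
proof -
  have bound: "r \<le> length p" if "{1..r} \<subseteq> set p" for r
    using card_mono[OF _ that] card_length[of p] by simp
  have "{1..initial_run p} \<subseteq> set p"
    unfolding initial_run_def
    by (rule GreatestI_nat[of "\<lambda>r. {1..r} \<subseteq> set p" 0 "length p"]) (use bound in simp_all)
  moreover have "d \<le> initial_run p" if "{1..d} \<subseteq> set p"
    unfolding initial_run_def
    by (rule Greatest_le_nat[of "\<lambda>r. {1..r} \<subseteq> set p" d "length p"]) (use that bound in auto)
  ultimately show ?thesis
    by fastforce
qed

lemma initial_run_le_length: "initial_run p \<le> length p"
  using card_mono[of "set p" "{1..initial_run p}"] card_length[of p]
    le_initial_run_iff[of "initial_run p" p]
  by simp

text \<open>\<open>r\<close> lists the rows to the right of the square, padded with zeros to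
  \<open>d\<close> rows, and \<open>s\<close> the rows below it.\<close>

lemma bij_betw_durfee:
  assumes "d \<le> m"
  shows "bij_betw (\<lambda>(r, s). map (\<lambda>x. x + d) r @ s)
    (weak_parts d \<times> bounded_parts d (m - d)) (durfee_parts d m)"
proof (rule bij_betwI[where g = "\<lambda>p. (map (\<lambda>x. x - d) (take d p), drop d p)"])
  have "map (\<lambda>x. x + d) r @ s \<in> durfee_parts d m"
    if r: "r \<in> weak_parts d" and s: "s \<in> bounded_parts d (m - d)" for r s
  proof -
    have "durfee (map (\<lambda>x. x + d) r @ s) = d"
      using durfee_append[of "map (\<lambda>x. x + d) r" s] r s by (simp add: weak_parts_def bounded_parts_def)
    \<comment> \<open>A nonempty \<open>r\<close> has length \<open>d\<close>, so \<open>d\<close>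
      is positive and the padding zeros turn into genuine parts.\<close>
    moreover have "0 < x + d" if "x \<in> set r" for x
      using r that by (auto simp: weak_parts_def)
    moreover have "y \<le> x + d" if "y \<in> set s" for x y
      using s that by (auto simp: bounded_parts_def intro: le_trans)
    ultimately show ?thesis
      using r s assms
      by (auto simp: weak_parts_def bounded_parts_def durfee_parts_def partitions_def
          sorted_wrt_append sorted_wrt_map)
  qed
  then show "(\<lambda>(r, s). map (\<lambda>x. x + d) r @ s) \<in>
      weak_parts d \<times> bounded_parts d (m - d) \<rightarrow> durfee_parts d m"
    by auto
next
  have "map (\<lambda>x. x - d) (take d p) \<in> weak_parts d \<and> drop d p \<in> bounded_parts d (m - d)"
    if "p \<in> durfee_parts d m" for p
  proof -
    from that have p: "sorted_wrt (\<ge>) p" "length p = m" "durfee p = d" "\<forall>x\<in>set p. 0 < x"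
      by (auto simp: durfee_parts_def partitions_def)
    have "sorted_wrt (\<ge>) (map (\<lambda>x. x - d) (take d p))"
      using sorted_wrt_take[OF p(1), of d]
      by (auto simp: sorted_wrt_map intro!: sorted_wrt_mono_rel[of "take d p" "(\<ge>)"])
    then show ?thesis
      using durfee_split[OF p(1)] p assms sorted_wrt_drop[OF p(1), of d]
      by (auto simp: weak_parts_def bounded_parts_def partitions_def dest: in_set_dropD)
  qed
  then show "(\<lambda>p. (map (\<lambda>x. x - d) (take d p), drop d p)) \<in>
      durfee_parts d m \<rightarrow> weak_parts d \<times> bounded_parts d (m - d)"
    by auto
next
  fix z assume "z \<in> weak_parts d \<times> bounded_parts d (m - d)"
  then show "(\<lambda>p. (map (\<lambda>x. x - d) (take d p), drop d p))
      ((\<lambda>(r, s). map (\<lambda>x. x + d) r @ s) z) = z"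
    by (auto simp: weak_parts_def comp_def)
next
  fix p assume "p \<in> durfee_parts d m"
  \<comment> \<open>Subtraction on naturals truncates; it is undone here because the rows through
    the square have length at least \<open>d\<close>.\<close>
  then have "\<forall>x\<in>set (take d p). d \<le> x"
    using durfee_split(2)[of p] by (auto simp: durfee_parts_def partitions_def)
  then have "map (\<lambda>x. x + d) (map (\<lambda>x. x - d) (take d p)) = take d p"
    by (auto intro: map_idI)
  then show "(\<lambda>(r, s). map (\<lambda>x. x + d) r @ s)
      ((\<lambda>p. (map (\<lambda>x. x - d) (take d p), drop d p)) p) = p"
    by simp
qed

lemma finite_fibres_bounded_parts: "finite_fibres sum_list (bounded_parts n m)"
  by (rule finite_fibres_subset[OF finite_fibres_length[of m]]) (auto simp: bounded_parts_def)

lemma finite_fibres_durfee_parts: "finite_fibres sum_list (durfee_parts d m)"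
  by (rule finite_fibres_subset[OF finite_fibres_length[of m]]) (auto simp: durfee_parts_def)

lemma finite_fibres_distinct_run: "finite_fibres sum_list (distinct_run n d)"
  by (rule finite_fibres_subset[OF finite_fibres_length[of n]]) (auto simp: distinct_run_def)

text \<open>\<open>V\<close> stands for a condition on the whole partition that depends only on the
  rows \<open>r\<close> right of the square. The exponent \<open>d * d\<close> is the size of the
  square.\<close>

lemma gf_durfee_subset:
  assumes "d \<le> m" "A \<subseteq> weak_parts d"
    and "\<And>r s. r \<in> weak_parts d \<Longrightarrow> s \<in> bounded_parts d (m - d) \<Longrightarrow>
      map (\<lambda>x. x + d) r @ s \<in> V \<longleftrightarrow> r \<in> A"
  shows "gf sum_list (durfee_parts d m \<inter> V) =
    fps_X ^ (d * d) * (gf sum_list A * gf sum_list (bounded_parts d (m - d)))"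
proof -
  let ?h = "\<lambda>(r, s). map (\<lambda>x. x + d) r @ s"
  note bij = bij_betw_durfee[OF assms(1)]
  have "?h ` (A \<times> bounded_parts d (m - d)) = durfee_parts d m \<inter> V"
    unfolding bij_betw_imp_surj_on[OF bij, symmetric] using assms(2,3) by fastforce
  then have "bij_betw ?h (A \<times> bounded_parts d (m - d)) (durfee_parts d m \<inter> V)"
    using assms(2) by (intro bij_betw_subset[OF bij]) auto
  then have "gf sum_list (durfee_parts d m \<inter> V) =
      fps_X ^ (d * d) * gf (\<lambda>(r, s). sum_list r + sum_list s) (A \<times> bounded_parts d (m - d))"
    by (rule gf_bij_betw)
      (use assms(2) in \<open>auto simp: sum_list_addf sum_list_triv weak_parts_def\<close>)
  moreover have "finite_fibres sum_list A"
    using assms(2) finite_fibres_weak_parts by (rule finite_fibres_subset[rotated])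
  ultimately show ?thesis
    by (simp add: gf_Times finite_fibres_bounded_parts)
qed

lemma gf_durfee_parts:
  assumes "d \<le> m"
  shows "gf sum_list (durfee_parts d m) =
    fps_X ^ (d * d) * (gf sum_list (weak_parts d) * gf sum_list (bounded_parts d (m - d)))"
  using gf_durfee_subset[OF assms, of "weak_parts d" UNIV] by simp

text \<open>The parts below the square are at most \<open>d\<close> and hence at most
  \<open>n\<close>, so the bound \<open>n\<close> only confines the part to the right to
  \<open>n - d\<close> columns.\<close>

lemma gf_durfee_parts_bounded:
  assumes "d \<le> m" "d \<le> n"
  shows "gf sum_list (durfee_parts d m \<inter> {p. \<forall>x\<in>set p. x \<le> n}) =
    fps_X ^ (d * d) * (gf sum_list (box d (n - d)) * gf sum_list (bounded_parts d (m - d)))"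
  by (rule gf_durfee_subset[OF assms(1)])
    (use assms(2) in \<open>auto simp: box_def bounded_parts_def le_diff_conv2 intro: le_trans\<close>)

lemma durfee_le:
  assumes "sorted_wrt (\<ge>) p" "\<forall>x\<in>set p. x \<le> n"
  shows "durfee p \<le> n"
proof (cases "durfee p = 0")
  case False
  then obtain x where "x \<in> set (take (durfee p) p)"
    using durfee_split(1)[OF assms(1)] by (cases p; cases "durfee p") auto
  then show ?thesis
    using durfee_split(2)[OF assms(1)] assms(2) by (meson in_set_takeD le_trans)
qed simp

text \<open>The partition lies in \<open>m\<close> rows and \<open>n\<close> columns, and so does
  its Durfee square; hence the range of \<open>d\<close>.\<close>

lemma gf_bounded_parts:
  "gf sum_list (bounded_parts n m) = (\<Sum>d\<le>min n m.
     fps_X ^ (d * d) * (gf sum_list (box d (n - d)) * gf sum_list (bounded_parts d (m - d))))"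
proof -
  let ?B = "{p. \<forall>x\<in>set p. x \<le> n}"
  have "bounded_parts n m = (\<Union>d\<le>min n m. durfee_parts d m \<inter> ?B)"
    using durfee_split(1) durfee_le
    by (fastforce simp: bounded_parts_def durfee_parts_def partitions_def)
  then have "gf sum_list (bounded_parts n m) = gf sum_list (\<Union>d\<le>min n m. durfee_parts d m \<inter> ?B)"
    by simp
  also have "\<dots> = (\<Sum>d\<le>min n m. gf sum_list (durfee_parts d m \<inter> ?B))"
    by (intro gf_UN finite_fibres_subset[OF finite_fibres_durfee_parts[of _ m]])
      (auto simp: durfee_parts_def)
  finally show ?thesis
    by (simp add: gf_durfee_parts_bounded)
qed

lemma distinct_run_bounded_eq_durfee:
  "gf sum_list (distinct_run n 0) * gf sum_list (bounded_parts n m) =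
     (\<Sum>d\<le>min n m. gf sum_list (distinct_run n d) * gf sum_list (durfee_parts d m))"
  unfolding gf_bounded_parts[of n m] sum_distrib_left
proof (rule sum.cong)
  fix d assume "d \<in> {..min n m}"
  then have d: "d \<le> n" "d \<le> m" by auto
  show "gf sum_list (distinct_run n 0) * (fps_X ^ (d * d) *
      (gf sum_list (box d (n - d)) * gf sum_list (bounded_parts d (m - d)))) =
    gf sum_list (distinct_run n d) * gf sum_list (durfee_parts d m)"
    \<comment> \<open>Both sides share the triangular power of q, the square and the part below it;
      the rest is the Gaussian binomial formula.\<close>
    using d gf_weak_parts_times_box[of d "n - d"]
    by (simp add: gf_distinct_run gf_durfee_parts algebra_simps)
qed simp

section \<open>From counts to sums of power series\<close>

definition total_size :: "nat list \<times> nat list \<Rightarrow> nat" where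
  "total_size = (\<lambda>(p1, p2). sum_list p1 + sum_list p2)"

definition lengths :: "nat list \<times> nat list \<Rightarrow> nat \<times> nat" where
  "lengths = (\<lambda>(p1, p2). (length p1, length p2))"

lemma length_le_sum_list: "\<forall>x\<in>set p. 0 < x \<Longrightarrow> length p \<le> sum_list (p :: nat list)"
  by (induction p) auto

text \<open>Parts are positive, so a given size allows only finitely many pairs of lengths.\<close>

lemma total_size_bounds:
  assumes "z \<in> partitions \<times> partitions" "total_size z = k"
  shows "lengths z \<in> {..k} \<times> {..k}"
proof -
  obtain p1 p2 where "z = (p1, p2)"
    by (cases z)
  with assms length_le_sum_list[of p1] length_le_sum_list[of p2] show ?thesis
    by (auto simp: partitions_def total_size_def lengths_def)
qed

lemma finite_total_size:
  assumes "A \<subseteq> partitions \<times> partitions"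
  shows "finite {z\<in>A. total_size z = k}"
proof -
  let ?Z = "{p. set p \<subseteq> {..k} \<and> length p \<le> k}"
  have "{z\<in>A. total_size z = k} \<subseteq> ?Z \<times> ?Z"
  proof
    fix z assume z: "z \<in> {z\<in>A. total_size z = k}"
    obtain p1 p2 where z': "z = (p1, p2)"
      by (cases z)
    have "lengths z \<in> {..k} \<times> {..k}"
      using z assms by (intro total_size_bounds) auto
    with z show "z \<in> ?Z \<times> ?Z"
      using member_le_sum_list[of _ p1] member_le_sum_list[of _ p2]
      by (fastforce simp: z' total_size_def lengths_def)
  qed
  then show ?thesis
    by (rule finite_subset) (auto simp: finite_lists_length_le)
qed

text \<open>The monomial t^(n+m) a^m b^n in the coefficient ring, where \<open>a\<close> is the
  outermost variable, then \<open>b\<close>, then \<open>t\<close>.\<close>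

definition weight_coeff :: "nat \<times> nat \<Rightarrow> int fps fps fps" where
  "weight_coeff = (\<lambda>(n, m). fps_const (fps_const fps_X) ^ (n + m) * fps_X ^ m * fps_const fps_X ^ n)"

lemma weight_nth: "weight z $ k = (if total_size z = k then weight_coeff (lengths z) else 0)"
proof (cases z)
  case (Pair p1 p2)
  have "weight z = fps_const (weight_coeff (lengths z)) * fps_X ^ total_size z"
    by (simp add: Pair weight_def weight_coeff_def lengths_def total_size_def var_t_def var_a_def
        var_b_def var_q_def)
  then show ?thesis
    by (simp add: fps_X_power_nth)
qed

text \<open>Each power of q receives only finitely many terms, which gives convergence. Grouping
  them by lengths shows that the sum depends on \<open>A\<close> only through cardinalities, so it
  suffices to compare counts.\<close>

lemma weight_has_sum:
  assumes A: "A \<subseteq> partitions \<times> partitions"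
  shows "(weight has_sum Abs_fps (\<lambda>k. \<Sum>y\<in>{..k} \<times> {..k}.
    of_nat (card {z\<in>A. lengths z = y \<and> total_size z = k}) * weight_coeff y)) A"
proof (rule has_sum_fpsI)
  fix k
  show "finite {z\<in>A. weight z $ k \<noteq> 0}"
    by (rule finite_subset[OF _ finite_total_size[OF A, of k]]) (auto simp: weight_nth split: if_splits)
  let ?S = "{z\<in>A. total_size z = k}"
  have "(\<Sum>z | z \<in> A \<and> weight z $ k \<noteq> 0. weight z $ k) = (\<Sum>z\<in>?S. weight_coeff (lengths z))"
    by (rule sum.mono_neutral_cong_left) (auto simp: weight_nth finite_total_size[OF A] split: if_splits)
  also have "\<dots> = (\<Sum>y\<in>{..k} \<times> {..k}. \<Sum>z | z \<in> ?S \<and> lengths z = y. weight_coeff (lengths z))"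
    using total_size_bounds A by (intro sum.group[symmetric] finite_total_size) blast+
  also have "\<dots> = (\<Sum>y\<in>{..k} \<times> {..k}.
      of_nat (card {z\<in>A. lengths z = y \<and> total_size z = k}) * weight_coeff y)"
    by (intro sum.cong) (auto intro!: arg_cong[where f = card])
  finally show "Abs_fps (\<lambda>k. \<Sum>y\<in>{..k} \<times> {..k}.
      of_nat (card {z\<in>A. lengths z = y \<and> total_size z = k}) * weight_coeff y) $ k =
    (\<Sum>z | z \<in> A \<and> weight z $ k \<noteq> 0. weight z $ k)"
    by simp
qed

lemma largest_part_le_iff: "largest_part p \<le> n \<longleftrightarrow> (\<forall>x\<in>set p. x \<le> n)"
  by (simp add: largest_part_def)

theorem theorem5:
  defines "L \<equiv> {(p1, p2) \<in> distinct_partitions \<times> partitions. largest_part p2 \<le> length p1}"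
    and "R \<equiv> {(p1, p2) \<in> distinct_partitions \<times> partitions. durfee p2 \<le> initial_run p1}"
  shows "weight summable_on L \<and> weight summable_on R \<and> infsum weight L = infsum weight R"
proof -
  have sub: "L \<subseteq> partitions \<times> partitions" "R \<subseteq> partitions \<times> partitions"
    by (auto simp: L_def R_def distinct_partitions_def)
  have "card {z\<in>L. lengths z = (n, m) \<and> total_size z = k} =
      card {z\<in>R. lengths z = (n, m) \<and> total_size z = k}" for n m k
  proof -
    let ?L = "distinct_run n 0 \<times> bounded_parts n m"
      and ?R = "\<lambda>d. distinct_run n d \<times> durfee_parts d m"
    have L: "{z\<in>L. lengths z = (n, m) \<and> total_size z = k} = {z\<in>?L. total_size z = k}"
      by (auto simp: L_def lengths_def distinct_run_def bounded_parts_def largest_part_le_iff)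
    \<comment> \<open>The pairs are sorted by the Durfee side \<open>d\<close> of \<open>p2\<close>.
      It is at most \<open>m\<close> as the square has \<open>d\<close> rows, and at most
      \<open>n\<close> as the run in \<open>p1\<close> has at most \<open>n\<close>
      elements.\<close>
    have "(p1, p2) \<in> R \<and> lengths (p1, p2) = (n, m) \<longleftrightarrow>
        (p1, p2) \<in> (\<Union>d\<le>min n m. ?R d)" for p1 p2
    proof -
      have "durfee p2 \<le> length p2" if "p2 \<in> partitions"
        using that by (auto simp: partitions_def intro: durfee_split(1))
      then show ?thesis
        using initial_run_le_length[of p1]
        by (auto simp: R_def lengths_def distinct_run_def durfee_parts_def
            le_initial_run_iff[symmetric] simp del: One_nat_def)
    qed
    then have R: "{z\<in>R. lengths z = (n, m) \<and> total_size z = k} =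
        {z\<in>\<Union>d\<le>min n m. ?R d. total_size z = k}"
      by fast
    have "gf total_size ?L = gf sum_list (distinct_run n 0) * gf sum_list (bounded_parts n m)"
      unfolding total_size_def
      by (rule gf_Times[OF finite_fibres_distinct_run finite_fibres_bounded_parts])
    also have "\<dots> = (\<Sum>d\<le>min n m. gf sum_list (distinct_run n d) * gf sum_list (durfee_parts d m))"
      by (rule distinct_run_bounded_eq_durfee)
    also have "\<dots> = (\<Sum>d\<le>min n m. gf total_size (?R d))"
      unfolding total_size_def
      by (simp add: gf_Times[OF finite_fibres_distinct_run finite_fibres_durfee_parts])
    also have "\<dots> = gf total_size (\<Union>d\<le>min n m. ?R d)"
      unfolding total_size_def
      \<comment> \<open>The pieces are disjoint because \<open>p2\<close> determines its Durfee
        side.\<close>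
      by (intro gf_UN[symmetric] gf_Times(2) finite_fibres_distinct_run finite_fibres_durfee_parts)
        (auto simp: durfee_parts_def)
    finally have "gf total_size ?L $ k = gf total_size (\<Union>d\<le>min n m. ?R d) $ k"
      by simp
    then show ?thesis
      unfolding L R by simp
  qed
  then have "Abs_fps (\<lambda>k. \<Sum>y\<in>{..k} \<times> {..k}.
        of_nat (card {z\<in>L. lengths z = y \<and> total_size z = k}) * weight_coeff y) =
      Abs_fps (\<lambda>k. \<Sum>y\<in>{..k} \<times> {..k}.
        of_nat (card {z\<in>R. lengths z = y \<and> total_size z = k}) * weight_coeff y)" (is "?SL = ?SR")
    by (intro arg_cong[where f = Abs_fps] ext sum.cong) auto
  moreover have L: "(weight has_sum ?SL) L" and R: "(weight has_sum ?SR) R"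
    using weight_has_sum sub by blast+
  ultimately have "infsum weight L = infsum weight R"
    using infsumI[OF L] infsumI[OF R] by (simp only:)
  with L R show ?thesis
    by (blast intro: has_sum_imp_summable)
qed

end
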